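(* There exist a stationary ergodic real-valued process $\{X_i\}_{i=-\infty}^{\infty}$ whose marginal distribution is uniform on $[0,1)$, and a sequence of partitions $\mathcal{P}_n=\{A_{n,j}\}_j$ of the real line satisfying, for every bounded interval $S$ symmetric around $0$, $$\lim_{n\to\infty}\ \sup_{j:\,A_{n,j}\cap S\neq\emptyset}\operatorname{diam}(A_{n,j})=0 \qquad\text{and}\qquad \lim_{n\to\infty}\frac{|\{j: A_{n,j}\cap S\neq\emptyset\}|}{n}=0,$$ such that, with $m(x)=E(X_0\mid X_{-1}=x)$ and with the partitioning forecaster $\hat m_n$ built from $\{X_i\}$ and $\mathcal{P}_n$, $$P\Bigl(\limsup_{n\to\infty}\bigl|\hat m_n(X_{-1})-m(X_{-1})\bigr|\ge 0.5\Bigr)\ge 0.5 .$$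
   Context: Partitions of the real line are into Borel sets. For a partition $\mathcal{P}_n=\{A_{n,j}\}_j$ of $\mathbb{R}$, $A_n(x)$ denotes the cell $A_{n,j}$ of $\mathcal{P}_n$ into which $x$ falls. For a stationary real-valued process $\{X_i\}_{i=-\infty}^{\infty}$ and $n\ge 2$, the partitioning estimate of the autoregression function $m(x)=E(X_0\mid X_{-1}=x)$ based on the data $X_{-n},\dots,X_{-1}$ is $$\hat m_n(x)=\frac{\sum_{i=1}^{n-1} I_{[X_{-1-i}\in A_n(x)]}\,X_{-i}}{\sum_{i=1}^{n-1} I_{[X_{-1-i}\in A_n(x)]}},$$ with the convention $0/0=0$, where $I_{[\cdot]}$ is the indicator. The partitioning forecaster of $E(X_0\mid X_{-1})$ is $\hat m_n(X_{-1})$, i.e. $\hat m_n$ evaluated at the random point $x=X_{-1}$. Cells $A_{n,j}$ need not be intervals. $\operatorname{diam}(A)=\sup_{x,y\in A}|x-y|$, and $|\{\cdot\}|$ denotes cardinality. *)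

theory Defs
  imports "HOL-Probability.Probability"
begin

definition seq_space :: "(int \<Rightarrow> real) measure" where
  "seq_space = (\<Pi>\<^sub>M i\<in>UNIV. borel)"

definition trajectory :: "(int \<Rightarrow> 'a \<Rightarrow> real) \<Rightarrow> 'a \<Rightarrow> int \<Rightarrow> real" where
  "trajectory X \<omega> = (\<lambda>i. X i \<omega>)"

definition shift :: "int \<Rightarrow> (int \<Rightarrow> real) \<Rightarrow> int \<Rightarrow> real" where
  "shift k x = (\<lambda>i. x (i + k))"

definition real_process :: "'a measure \<Rightarrow> (int \<Rightarrow> 'a \<Rightarrow> real) \<Rightarrow> bool" where
  "real_process M X \<longleftrightarrow> prob_space M \<and> (\<forall>i. X i \<in> borel_measurable M)"

definition stationary :: "'a measure \<Rightarrow> (int \<Rightarrow> 'a \<Rightarrow> real) \<Rightarrow> bool" where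
  "stationary M X \<longleftrightarrow>
     (\<forall>k. distr M seq_space (\<lambda>\<omega>. shift k (trajectory X \<omega>)) = distr M seq_space (trajectory X))"

definition ergodic :: "'a measure \<Rightarrow> (int \<Rightarrow> 'a \<Rightarrow> real) \<Rightarrow> bool" where
  "ergodic M X \<longleftrightarrow>
     (\<forall>B \<in> sets seq_space. shift 1 -` B = B \<longrightarrow>
        measure (distr M seq_space (trajectory X)) B \<in> {0, 1})"

definition borel_partition :: "real set set \<Rightarrow> bool" where
  "borel_partition Q \<longleftrightarrow> partition_on UNIV Q \<and> countable Q \<and> Q \<subseteq> sets borel"

definition cell :: "real set set \<Rightarrow> real \<Rightarrow> real set" where
  "cell Q x = (THE A. A \<in> Q \<and> x \<in> A)"

definition cells_meeting :: "real set set \<Rightarrow> real set \<Rightarrow> real set set" where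
  "cells_meeting Q S = {A \<in> Q. A \<inter> S \<noteq> {}}"

(* Extended-valued, so that an unbounded cell has infinite diameter; the library
   function diameter is real-valued and unspecified on unbounded sets. *)
definition ediam :: "real set \<Rightarrow> ennreal" where
  "ediam A = (SUP x\<in>A. SUP y\<in>A. ennreal \<bar>x - y\<bar>)"

definition symmetric_bounded_interval :: "real set \<Rightarrow> bool" where
  "symmetric_bounded_interval S \<longleftrightarrow> is_interval S \<and> bounded S \<and> uminus ` S = S"

(* Finiteness is explicit because card is 0 on infinite sets; a ratio that tends to 0
   only forces the number of cells to be finite for all large n. *)
definition fine_partitions :: "(nat \<Rightarrow> real set set) \<Rightarrow> bool" where
  "fine_partitions P \<longleftrightarrow>
     (\<forall>S. symmetric_bounded_interval S \<longrightarrow>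
        (\<lambda>n. SUP A\<in>cells_meeting (P n) S. ediam A) \<longlonglongrightarrow> 0 \<and>
        (\<forall>\<^sub>F n in sequentially. finite (cells_meeting (P n) S)) \<and>
        (\<lambda>n. real (card (cells_meeting (P n) S)) / real n) \<longlonglongrightarrow> 0)"

(* Division by zero is zero in HOL, and a vanishing denominator makes the numerator
   vanish too, so this realises the convention 0/0 = 0. *)
definition partitioning_estimate ::
    "real set set \<Rightarrow> nat \<Rightarrow> (int \<Rightarrow> real) \<Rightarrow> real \<Rightarrow> real" where
  "partitioning_estimate Q n z x =
     (\<Sum>i = 1..<n. indicator (cell Q x) (z (- 1 - int i)) * z (- int i)) /
     (\<Sum>i = 1..<n. indicator (cell Q x) (z (- 1 - int i)))"

(* m is a version of x \<mapsto> E(Y | Z = x); it is unique up to null sets of the law of Z. *)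
definition regression_function ::
    "'a measure \<Rightarrow> ('a \<Rightarrow> real) \<Rightarrow> ('a \<Rightarrow> real) \<Rightarrow> (real \<Rightarrow> real) \<Rightarrow> bool" where
  "regression_function M Y Z m \<longleftrightarrow>
     m \<in> borel_measurable borel \<and>
     (AE \<omega> in M. m (Z \<omega>) = real_cond_exp M (vimage_algebra (space M) Z borel) Y \<omega>)"

end

theory Submission
  imports Defs
begin

text \<open>
  An i.i.d. uniform sequence already works; here \<open>m = 1 / 2\<close>. The idea is to make the forecast \<open>0\<close>
  infinitely often through the convention \<open>0 / 0 = 0\<close>. In the \<open>r\<close>-th block of times, starting at
  \<open>r ^ 3\<close> and of length \<open>r\<^sup>2\<close>, each point of \<open>[0, 1)\<close> lies exactly once in a cell of length
  \<open>r ^ (- 4)\<close>, although at each time there are only about \<open>r\<^sup>2\<close> cells. By the union bound, none of the at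
  most \<open>r ^ 3 + r\<^sup>2\<close> data points seen during the block lies in the same tiny cell as \<open>X\<^bsub>-1\<^esub>\<close> with
  probability at least \<open>1 - 2 / r\<close>, and on this event the forecast vanishes at the time in the block
  when the cell of \<open>X\<^bsub>-1\<^esub>\<close> is tiny. Hence almost surely the error is \<open>1 / 2\<close> infinitely often.
\<close>

subsection \<open>Sequences of independent identically distributed variables\<close>

text \<open>Stationarity, ergodicity and the form of the regression function are proved for a
  general marginal law \<open>N\<close>; the uniform law enters only with
  \<open>unif\<close>.\<close>

locale iid_sequence = prob_space N for N :: "real measure" +
  assumes sets_N [measurable_cong, simp]: "sets N = sets borel"
begin

abbreviation iid :: "(int \<Rightarrow> real) measure" where
  "iid \<equiv> \<Pi>\<^sub>M i\<in>UNIV. N"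

abbreviation coord :: "int \<Rightarrow> (int \<Rightarrow> real) \<Rightarrow> real" where
  "coord i \<omega> \<equiv> \<omega> i"

lemma space_N [simp]: "space N = UNIV"
  using sets_eq_imp_space_eq[OF sets_N] by simp

lemma space_iid [simp]: "space iid = UNIV"
  by (auto simp: space_PiM PiE_def extensional_def)

lemma sets_iid [measurable_cong]: "sets iid = sets seq_space"
  unfolding seq_space_def by (intro sets_PiM_cong) simp_all

lemma sets_iid_eq_sigma_sets: "sets iid = sigma_sets UNIV (prod_algebra UNIV (\<lambda>_. N))"
  using space_iid by (simp add: sets_PiM space_PiM)

sublocale iid: product_prob_space "\<lambda>_. N" "UNIV :: int set"
  by unfold_locales

lemma coord_measurable [measurable]: "(\<lambda>\<omega>. \<omega> i) \<in> iid \<rightarrow>\<^sub>M borel"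
  by (rule measurable_compose[OF measurable_component_singleton[of i UNIV]]) (simp_all add: measurable_ident_sets)

lemma coord_vimage_sets: "A \<in> sets borel \<Longrightarrow> coord i -` A \<in> sets iid"
  using measurable_sets[OF coord_measurable, of A i] by simp

lemma distr_trajectory_coord: "distr iid seq_space (trajectory coord) = iid"
proof -
  have "trajectory coord = (\<lambda>\<omega>. \<omega>)"
    by (simp add: trajectory_def fun_eq_iff)
  then show ?thesis
    by (simp add: distr_id2 sets_iid)
qed

lemma shift_measurable [measurable]: "shift k \<in> iid \<rightarrow>\<^sub>M iid"
  unfolding shift_def
  by (rule measurable_PiM_single') (auto simp: space_PiM PiE_def extensional_def intro!: measurable_component_singleton)

text \<open>A shift permutes the index set, and a product of equal factors is invariant under
  reindexing.\<close>

lemma distr_shift: "distr iid iid (shift k) = iid"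
proof -
  have "distr iid iid (\<lambda>\<omega>. \<lambda>i\<in>UNIV. \<omega> (i + k)) = iid"
    by (rule distr_PiM_reindex) (auto intro!: prob_space_axioms inj_onI)
  then show ?thesis
    by (simp add: shift_def[abs_def] restrict_UNIV)
qed

lemma measure_shift_vimage:
  assumes "B \<in> sets iid"
  shows "iid.prob (shift k -` B) = iid.prob B"
proof -
  have "iid.prob B = measure (distr iid iid (shift k)) B"
    by (simp add: distr_shift)
  also have "\<dots> = iid.prob (shift k -` B)"
    using assms by (subst measure_distr) simp_all
  finally show ?thesis by simp
qed

lemma shift_vimage_sets [measurable]: "B \<in> sets iid \<Longrightarrow> shift k -` B \<in> sets iid"
  using measurable_sets[OF shift_measurable, of B k] by simp

lemma stationary_iid: "stationary iid coord"
proof -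
  have "(\<lambda>\<omega>. shift k (trajectory coord \<omega>)) = shift k" for k
    by (simp add: trajectory_def fun_eq_iff)
  moreover have "distr iid seq_space (shift k) = distr iid iid (shift k)" for k
    by (rule distr_cong) (simp_all add: sets_iid)
  ultimately show ?thesis
    by (simp add: stationary_def distr_trajectory_coord distr_shift)
qed

section \<open>Cylinder events, mixing and ergodicity of the shift\<close>

definition cylinder :: "int set \<Rightarrow> (int \<Rightarrow> real set) \<Rightarrow> (int \<Rightarrow> real) set" where
  "cylinder J E = {\<omega>. \<forall>j\<in>J. \<omega> j \<in> E j}"

lemma cylinder_eq_emb: "cylinder J E = prod_emb UNIV (\<lambda>_. N) J (Pi\<^sub>E J E)"
  by (auto simp: cylinder_def prod_emb_def space_PiM PiE_def extensional_def Pi_def)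

lemma prob_cylinder:
  assumes "finite J" "\<And>j. j \<in> J \<Longrightarrow> E j \<in> sets borel"
  shows "iid.prob (cylinder J E) = (\<Prod>j\<in>J. prob (E j))"
  unfolding cylinder_eq_emb using assms by (intro iid.measure_PiM_emb) auto

lemma prod_algebraE_cylinder:
  assumes "A \<in> prod_algebra UNIV (\<lambda>_::int. N)"
  obtains J E where "A = cylinder J E" "finite J" "\<And>j. j \<in> J \<Longrightarrow> E j \<in> sets borel"
proof -
  obtain J E where "A = prod_emb UNIV (\<lambda>_. N) J (Pi\<^sub>E J E)" "finite J" "\<And>j. j \<in> J \<Longrightarrow> E j \<in> sets N"
    using assms by (rule prod_algebraE) blast
  then show thesis
    by (intro that[of J E]) (simp_all add: cylinder_eq_emb)
qed

lemma shift_vimage_cylinder: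
  "shift k -` cylinder J E = cylinder ((\<lambda>j. j + k) ` J) (\<lambda>j. E (j - k))"
  by (auto simp: cylinder_def shift_def)

lemma prob_cylinder_Int_disjoint:
  assumes "finite J" "finite K" "J \<inter> K = {}"
    and E: "\<And>j. j \<in> J \<Longrightarrow> E j \<in> sets borel" and F: "\<And>j. j \<in> K \<Longrightarrow> F j \<in> sets borel"
  shows "iid.prob (cylinder J E \<inter> cylinder K F) = iid.prob (cylinder J E) * iid.prob (cylinder K F)"
proof -
  let ?G = "\<lambda>j. if j \<in> J then E j else F j"
  have "cylinder J E \<inter> cylinder K F = cylinder (J \<union> K) ?G"
    using assms(3) by (auto simp: cylinder_def)
  then have "iid.prob (cylinder J E \<inter> cylinder K F) = (\<Prod>j\<in>J \<union> K. prob (?G j))"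
    using assms by (simp only:) (intro prob_cylinder, auto)
  also have "\<dots> = (\<Prod>j\<in>J. prob (?G j)) * (\<Prod>j\<in>K. prob (?G j))"
    using assms by (intro prod.union_disjoint) auto
  also have "(\<Prod>j\<in>K. prob (?G j)) = (\<Prod>j\<in>K. prob (F j))"
    using assms(3) by (intro prod.cong) auto
  finally show ?thesis
    using assms by (simp add: prob_cylinder)
qed

lemma eventually_translate_disjoint:
  fixes J K :: "int set"
  assumes "finite J" "finite K"
  shows "\<forall>\<^sub>F n in sequentially. J \<inter> (\<lambda>j. j + int n) ` K = {}"
proof -
  obtain b where b: "\<And>j. j \<in> J \<Longrightarrow> j \<le> b"
    using bdd_above_finite[OF assms(1)] by (auto simp: bdd_above_def)
  obtain c where c: "\<And>j. j \<in> K \<Longrightarrow> c \<le> j"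
    using bdd_below_finite[OF assms(2)] by (auto simp: bdd_below_def)
  show ?thesis
    \<comment> \<open>For such \<open>n\<close> the least possible element \<open>c + n\<close> of
      the translate exceeds the upper bound \<open>b\<close> of \<open>J\<close>.\<close>
    using eventually_ge_at_top[of "nat (b - c + 1)"]
    by eventually_elim (force dest: b c)
qed

text \<open>For fixed \<open>A\<close> the sets \<open>B\<close> with this limit form a Dynkin
  system. It contains the cylinders, because shifting far enough separates the finitely many
  coordinates of \<open>A\<close> and \<open>B\<close> and makes the two events independent. The
  cylinders are intersection-stable and generate the sigma-algebra.\<close>

lemma mixing_cylinder:
  assumes A: "A \<in> prod_algebra UNIV (\<lambda>_::int. N)" and B: "B \<in> sets iid"
  shows "(\<lambda>n. iid.prob (A \<inter> shift (int n) -` B)) \<longlonglongrightarrow> iid.prob A * iid.prob B"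
proof -
  let ?G = "prod_algebra UNIV (\<lambda>_::int. N)"
  note sets = sets_iid_eq_sigma_sets
  have A': "A \<in> sets iid"
    using A by (auto simp: sets)
  have "Int_stable ?G" "?G \<subseteq> Pow UNIV" "B \<in> sigma_sets UNIV ?G"
    using B by (auto simp: Int_stable_prod_algebra sets)
  then show ?thesis
  proof (induction rule: sigma_sets_induct_disjoint)
    case (basic B)
    obtain J E where J: "A = cylinder J E" "finite J" "\<And>j. j \<in> J \<Longrightarrow> E j \<in> sets borel"
      using A by (rule prod_algebraE_cylinder) blast
    obtain K F where K: "B = cylinder K F" "finite K" "\<And>j. j \<in> K \<Longrightarrow> F j \<in> sets borel"
      using basic by (rule prod_algebraE_cylinder) blast
    have B: "B \<in> sets iid"
      using basic by (auto simp: sets)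
    have "\<forall>\<^sub>F n in sequentially. iid.prob (A \<inter> shift (int n) -` B) = iid.prob A * iid.prob B"
      using eventually_translate_disjoint[OF J(2) K(2)]
    proof eventually_elim
      case (elim n)
      have "iid.prob (A \<inter> shift (int n) -` B) = iid.prob A * iid.prob (shift (int n) -` B)"
        unfolding J(1) K(1) shift_vimage_cylinder
        using J K elim by (intro prob_cylinder_Int_disjoint) auto
      then show ?case
        by (simp add: measure_shift_vimage B)
    qed
    then show ?case
      by (rule tendsto_eventually)
  next
    case empty
    show ?case by simp
  next
    case (compl B)
    then have B: "B \<in> sets iid"
      by (simp add: sets)
    have "A \<inter> shift (int n) -` (UNIV - B) = A - A \<inter> shift (int n) -` B" for n
      by auto
    then have "iid.prob (A \<inter> shift (int n) -` (UNIV - B))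
        = iid.prob A - iid.prob (A \<inter> shift (int n) -` B)" for n
      using A' B by (simp add: iid.finite_measure_Diff)
    moreover have "iid.prob A * iid.prob (UNIV - B) = iid.prob A - iid.prob A * iid.prob B"
      using iid.prob_compl[OF B] by (simp add: right_diff_distrib)
    ultimately show ?case
      using compl by (auto intro!: tendsto_diff)
  next
    case (union C)
    then have C: "range C \<subseteq> sets iid"
      by (simp add: sets)
    then have C': "C i \<in> sets iid" for i
      by auto
    have sums_C: "(\<lambda>i. iid.prob (C i)) sums iid.prob (\<Union>i. C i)"
      using C union(1) by (rule iid.finite_measure_UNION)
    have sums_n: "(\<lambda>i. iid.prob (A \<inter> shift (int n) -` C i)) sums
        iid.prob (A \<inter> shift (int n) -` (\<Union>i. C i))" for n
    proof -
      have "(\<lambda>i. iid.prob (A \<inter> shift (int n) -` C i)) sums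
          iid.prob (\<Union>i. A \<inter> shift (int n) -` C i)"
        using C' A' union(1) by (intro iid.finite_measure_UNION) (auto simp: disjoint_family_on_def)
      also have "(\<Union>i. A \<inter> shift (int n) -` C i) = A \<inter> shift (int n) -` (\<Union>i. C i)"
        by auto
      finally show ?thesis .
    qed
    \<comment> \<open>By shift invariance this summable bound does not depend on \<open>n\<close>,
      so Tannery's theorem allows the limit to be taken term by term.\<close>
    have "norm (iid.prob (A \<inter> shift (int n) -` C i)) \<le> iid.prob (C i)" for n i
      using iid.finite_measure_mono[of "A \<inter> shift (int n) -` C i" "shift (int n) -` C i"]
        C' by (simp add: measure_shift_vimage)
    then have "\<forall>\<^sub>F (i, n) in sequentially \<times>\<^sub>F sequentially.
        norm (iid.prob (A \<inter> shift (int n) -` C i)) \<le> iid.prob (C i)"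
      by (intro always_eventually) auto
    then have "(\<lambda>n. \<Sum>i. iid.prob (A \<inter> shift (int n) -` C i)) \<longlonglongrightarrow> (\<Sum>i. iid.prob A * iid.prob (C i))"
      using tannerys_theorem[of "\<lambda>i n. iid.prob (A \<inter> shift (int n) -` C i)", OF union(3)] sums_C
      by (simp add: sums_iff)
    then show ?case
      using sums_n sums_C by (simp add: sums_iff suminf_mult)
  qed
qed

text \<open>For an invariant \<open>B\<close> the sequence in the mixing limit is constant, so
  \<open>B\<close> is independent of every cylinder. Hence it is independent of the whole generated
  sigma-algebra, in particular of itself, and its probability \<open>p\<close> satisfies
  \<open>p = p * p\<close>.\<close>

lemma ergodic_iid: "ergodic iid coord"
  unfolding ergodic_def distr_trajectory_coord
proof (intro ballI impI)
  fix B assume "B \<in> sets seq_space" and inv: "shift 1 -` B = B"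
  then have B: "B \<in> sets iid"
    by (simp add: sets_iid)
  have inv_n: "shift (int n) -` B = B" for n
  proof (induction n)
    case 0
    then show ?case by (auto simp: shift_def)
  next
    case (Suc n)
    have "shift (int (Suc n)) -` B = shift (int n) -` (shift 1 -` B)"
      by (auto simp: shift_def add_ac)
    then show ?case
      by (simp add: inv Suc)
  qed
  let ?G = "prod_algebra UNIV (\<lambda>_::int. N)"
  note sets = sets_iid_eq_sigma_sets
  have "iid.prob (A \<inter> B) = iid.prob A * iid.prob B" if "A \<in> ?G" for A
    using mixing_cylinder[OF that B] by (simp add: inv_n LIMSEQ_const_iff)
  then have "iid.indep_set ?G {B}"
    using B by (intro iid.indep_setI) (auto simp: sets)
  then have "iid.indep_set (sigma_sets (space iid) ?G) (sigma_sets (space iid) {B})"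
    by (rule iid.indep_set_sigma_sets) (simp_all add: Int_stable_prod_algebra, simp add: Int_stable_def)
  then have "iid.prob (B \<inter> B) = iid.prob B * iid.prob B"
    by (rule iid.indep_setD) (use B sets in auto)
  then show "iid.prob B \<in> {0, 1}"
    by simp
qed

lemma prob_coord_pair:
  assumes "i \<noteq> j" "A \<in> sets borel" "B \<in> sets borel"
  shows "iid.prob {\<omega>. \<omega> i \<in> A \<and> \<omega> j \<in> B} = prob A * prob B"
proof -
  have "{\<omega>. \<omega> i \<in> A \<and> \<omega> j \<in> B} = cylinder {i, j} (\<lambda>k. if k = i then A else B)"
    using assms(1) by (auto simp: cylinder_def)
  then show ?thesis
    using assms by (simp add: prob_cylinder)
qed

section \<open>Marginals, pairwise independence and the regression function\<close>

lemma distr_coord: "distr iid borel (\<lambda>\<omega>. \<omega> i) = N"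
proof -
  have "distr iid borel (\<lambda>\<omega>. \<omega> i) = distr iid N (\<lambda>\<omega>. \<omega> i)"
    by (rule distr_cong) simp_all
  then show ?thesis
    using iid.PiM_component[of i] by simp
qed

lemma real_process_iid: "real_process iid coord"
  by (simp add: real_process_def iid.prob_space_axioms)

lemma indep_var_coord:
  assumes "i \<noteq> j"
  shows "iid.indep_var borel (coord i) borel (coord j)"
proof -
  have stable: "Int_stable {coord k -` A \<inter> space iid | A. A \<in> sets borel}" for k
  proof (rule Int_stableI)
    fix a b assume "a \<in> {coord k -` A \<inter> space iid | A. A \<in> sets borel}"
      and "b \<in> {coord k -` A \<inter> space iid | A. A \<in> sets borel}"
    then obtain A B where "A \<in> sets borel" "B \<in> sets borel"
        "a = coord k -` A \<inter> space iid" "b = coord k -` B \<inter> space iid"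
      by blast
    then show "a \<inter> b \<in> {coord k -` A \<inter> space iid | A. A \<in> sets borel}"
      by (intro CollectI exI[of _ "A \<inter> B"]) auto
  qed
  have prob_coord: "iid.prob (coord k -` A) = prob A" if "A \<in> sets borel" for k A
    using measure_distr[OF coord_measurable that, of k] by (simp add: distr_coord)
  have pair: "iid.prob (coord i -` A \<inter> coord j -` B) = prob A * prob B"
    if "A \<in> sets borel" "B \<in> sets borel" for A B
    using prob_coord_pair[OF assms that] by (simp add: vimage_def Collect_conj_eq)
  have "iid.indep_set {coord i -` A \<inter> space iid | A. A \<in> sets borel}
      {coord j -` A \<inter> space iid | A. A \<in> sets borel}"
    by (rule iid.indep_setI) (auto simp: pair prob_coord coord_vimage_sets)
  then show ?thesis
    unfolding iid.indep_var_eq by (intro conjI iid.indep_set_sigma_sets stable coord_measurable)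
qed

text \<open>The events of the conditioning sigma-algebra are those of the form
  \<open>\<omega> (- 1) \<in> B\<close>. Since coordinate 0 is independent of coordinate -1, its
  integral over such an event is the probability of the event times the mean, which is also the
  integral of the constant.\<close>

lemma regression_function_iid:
  assumes int: "integrable N (\<lambda>x. x)"
  shows "regression_function iid (coord 0) (coord (- 1)) (\<lambda>_. expectation (\<lambda>x. x))"
proof -
  let ?F = "vimage_algebra (space iid) (coord (- 1)) borel"
  have setsF: "sets (vimage_algebra UNIV (coord (- 1)) borel) = {coord (- 1) -` A | A. A \<in> sets borel}"
    by (subst sets_vimage_algebra2) simp_all
  have sub: "subalgebra iid ?F"
    by (simp add: subalgebra_def setsF) (auto simp: coord_vimage_sets)
  have subF: "sigma_finite_subalgebra iid ?F"
    by (intro finite_measure_subalgebra_is_sigma_finite finite_measure_subalgebra.intro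
        finite_measure_subalgebra_axioms.intro sub iid.finite_measure_axioms)
  have int_coord: "integrable iid (coord i)" for i
    using int by (subst (asm) distr_coord[of i, symmetric]) (rule integrable_distr[OF coord_measurable])
  have exp_coord: "iid.expectation (coord i) = expectation (\<lambda>x. x)" for i
    by (subst (2) distr_coord[of i, symmetric])
       (rule integral_distr[OF coord_measurable measurable_ident_sets[OF refl], symmetric])
  have "AE \<omega> in iid. real_cond_exp iid ?F (coord 0) \<omega> = expectation (\<lambda>x. x)"
  proof (rule sigma_finite_subalgebra.real_cond_exp_charact[OF subF])
    fix A assume "A \<in> sets ?F"
    then obtain B where B [measurable]: "B \<in> sets borel" and A: "A = {\<omega>. \<omega> (- 1) \<in> B}"
      by (auto simp: setsF)
    have "iid.indep_var borel (indicator B \<circ> coord (- 1)) borel ((\<lambda>x. x) \<circ> coord 0)"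
      by (rule iid.indep_var_compose[OF indep_var_coord]) auto
    then have ind: "iid.indep_var borel (\<lambda>\<omega>. indicator B (\<omega> (- 1)) :: real) borel (coord 0)"
      by (simp add: comp_def)
    have intB: "integrable iid (\<lambda>\<omega>. indicator B (\<omega> (- 1)) :: real)"
      by (rule iid.integrable_const_bound[of _ 1]) (auto simp: indicator_def)
    have "(LINT \<omega>:A|iid. coord 0 \<omega>) = iid.expectation (\<lambda>\<omega>. indicator B (\<omega> (- 1)) * coord 0 \<omega>)"
      by (simp add: set_lebesgue_integral_def A indicator_def)
    also have "\<dots> = iid.expectation (\<lambda>\<omega>. indicator B (\<omega> (- 1))) * expectation (\<lambda>x. x)"
      using iid.indep_var_lebesgue_integral[OF ind intB int_coord] by (simp add: exp_coord)
    also have "\<dots> = (LINT \<omega>:A|iid. expectation (\<lambda>x. x))"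
      by (simp add: set_lebesgue_integral_def A indicator_def)
    finally show "(LINT \<omega>:A|iid. coord 0 \<omega>) = (LINT \<omega>:A|iid. expectation (\<lambda>x. x))" .
  qed (simp_all add: int_coord)
  then show ?thesis
    by (auto simp: regression_function_def)
qed
end

subsection \<open>Partitions with a moving finely cut cell\<close>

text \<open>The number of the block containing time \<open>n\<close>: block \<open>r\<close>
  consists of the \<open>n\<close> with \<open>r ^ 3 \<le> n < (r + 1) ^ 3\<close>.\<close>

definition icbrt :: "nat \<Rightarrow> nat" where
  "icbrt n = nat \<lfloor>root 3 (real n)\<rfloor>"

lemma icbrt_cube_le: "icbrt n ^ 3 \<le> n"
proof -
  have "real (icbrt n) \<le> root 3 (real n)"
    by (simp add: icbrt_def)
  then have "real (icbrt n) ^ 3 \<le> root 3 (real n) ^ 3"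
    by (rule power_mono) simp
  then show ?thesis
    by (simp flip: of_nat_power)
qed

lemma le_icbrt: "r ^ 3 \<le> n \<Longrightarrow> r \<le> icbrt n"
proof -
  assume "r ^ 3 \<le> n"
  then have "root 3 (real r ^ 3) \<le> root 3 (real n)"
    by (intro real_root_le_mono) (simp_all flip: of_nat_power)
  then have "real r \<le> root 3 (real n)"
    by (simp add: real_root_power_cancel)
  then show ?thesis
    by (simp add: icbrt_def le_nat_floor)
qed

lemma icbrt_eqI: "r ^ 3 \<le> n \<Longrightarrow> n < Suc r ^ 3 \<Longrightarrow> icbrt n = r"
  using icbrt_cube_le[of n] le_icbrt[of r n]
  by (meson less_Suc_eq_le le_antisym le_trans not_less power_mono zero_le Suc_leI)

lemma filterlim_icbrt: "filterlim icbrt at_top sequentially"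
  unfolding filterlim_at_top
proof
  fix r :: nat
  show "\<forall>\<^sub>F n in sequentially. r \<le> icbrt n"
    using eventually_ge_at_top[of "r ^ 3"] by eventually_elim (rule le_icbrt)
qed

text \<open>Encoding a partition by a labelling function makes the cell of a point explicit and
  reduces measurability and cell counts to questions about labels. Taking only labels that occur
  keeps empty cells out.\<close>

definition fibres :: "('a \<Rightarrow> 'b) \<Rightarrow> 'a set set" where
  "fibres f = range (\<lambda>x. f -` {f x})"

lemma cell_fibres: "cell (fibres f) x = f -` {f x}"
  unfolding cell_def fibres_def by (rule the_equality) auto

lemma borel_partition_fibres:
  fixes f :: "real \<Rightarrow> 'b :: countable"
  assumes "f \<in> borel \<rightarrow>\<^sub>M count_space UNIV"
  shows "borel_partition (fibres f)"
proof -
  have "fibres f = (\<lambda>c. f -` {c}) ` range f"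
    by (auto simp: fibres_def)
  then have "countable (fibres f)"
    by simp
  moreover have "f -` {c} \<in> sets borel" for c
    using measurable_sets[OF assms, of "{c}"] by simp
  moreover have "partition_on UNIV (fibres f)"
    by (rule partition_onI) (auto simp: fibres_def disjnt_def)
  ultimately show ?thesis
    by (auto simp: borel_partition_def fibres_def)
qed

lemma cells_meeting_fibres: "cells_meeting (fibres f) S = (\<lambda>c. f -` {c}) ` f ` S"
  by (auto simp: cells_meeting_def fibres_def image_iff) (metis vimage_singleton_eq)+

text \<open>The first component locates the point in the grid of mesh \<open>1 / K\<close>. The
  second refines cell \<open>t\<close> alone: elsewhere it is constant and separates
  nothing.\<close>

definition label :: "nat \<Rightarrow> int \<Rightarrow> nat \<Rightarrow> real \<Rightarrow> int \<times> int" where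
  "label K t D x = (\<lfloor>real K * x\<rfloor>, if \<lfloor>real K * x\<rfloor> = t then \<lfloor>real D * x\<rfloor> else 0)"

lemma measurable_label [measurable]: "label K t D \<in> borel \<rightarrow>\<^sub>M count_space UNIV"
  unfolding label_def by measurable

lemma ediam_fibre_label_le:
  assumes "0 < K"
  shows "ediam (label K t D -` {c}) \<le> ennreal (1 / real K)"
  unfolding ediam_def
proof (intro SUP_least ennreal_leI)
  fix x y assume "x \<in> label K t D -` {c}" "y \<in> label K t D -` {c}"
  then have "\<lfloor>real K * x\<rfloor> = \<lfloor>real K * y\<rfloor>"
    by (auto simp: label_def)
  then have "\<bar>real K * x - real K * y\<bar> \<le> 1"
    by linarith
  then have "real K * \<bar>x - y\<bar> \<le> 1"
    by (simp add: abs_mult flip: right_diff_distrib)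
  then show "\<bar>x - y\<bar> \<le> 1 / real K"
    using assms by (simp add: field_simps)
qed

text \<open>The first set holds the labels of the uncut cells, the second those of the pieces of
  cell \<open>t\<close>: multiplying \<open>t \<le> K * x < t + 1\<close> by \<open>L\<close> leaves
  \<open>L\<close> possible values for the fine floor. The union makes the cost of cutting additive
  rather than multiplicative.\<close>

lemma label_image_subset:
  fixes s L :: nat
  assumes "S \<subseteq> {- real s..real s}" and L: "0 < L"
  shows "label K t (K * L) ` S \<subseteq> {- int (s * K)..int (s * K)} \<times> {0} \<union> {t} \<times> {t * int L..<t * int L + int L}"
proof
  fix c assume "c \<in> label K t (K * L) ` S"
  then obtain x where x: "- real s \<le> x" "x \<le> real s" and c: "c = label K t (K * L) x"
    using assms by force
  have "real K * x \<le> real s * real K" "- (real s * real K) \<le> real K * x"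
    using mult_left_mono[OF x(1), of "real K"] mult_left_mono[OF x(2), of "real K"] by (simp_all add: mult_ac)
  then have "- int (s * K) \<le> \<lfloor>real K * x\<rfloor>" "\<lfloor>real K * x\<rfloor> \<le> int (s * K)"
    by (simp_all add: le_floor_iff floor_le_iff)
  moreover have "t * int L \<le> \<lfloor>real (K * L) * x\<rfloor> \<and> \<lfloor>real (K * L) * x\<rfloor> < t * int L + int L"
    if "\<lfloor>real K * x\<rfloor> = t"
  proof -
    have "real_of_int t \<le> real K * x" "real K * x < real_of_int t + 1"
      using that by linarith+
    then have "real_of_int t * real L \<le> real K * x * real L" "real K * x * real L < (real_of_int t + 1) * real L"
      using L by simp_all
    then show ?thesis
      by (simp add: le_floor_iff floor_less_iff algebra_simps)
  qed
  ultimately show "c \<in> {- int (s * K)..int (s * K)} \<times> {0} \<union> {t} \<times> {t * int L..<t * int L + int L}"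
    by (auto simp: c label_def)
qed

lemma card_label_image_le:
  fixes s L :: nat
  assumes "S \<subseteq> {- real s..real s}" "0 < L"
  shows "finite (label K t (K * L) ` S)" "card (label K t (K * L) ` S) \<le> 2 * s * K + 1 + L"
proof -
  let ?B = "{- int (s * K)..int (s * K)} \<times> {0 :: int}" and ?C = "{t} \<times> {t * int L..<t * int L + int L}"
  show "finite (label K t (K * L) ` S)"
    by (rule finite_subset[OF label_image_subset[OF assms]]) simp
  have "card (label K t (K * L) ` S) \<le> card (?B \<union> ?C)"
    by (rule card_mono[OF _ label_image_subset[OF assms]]) simp
  also have "\<dots> \<le> card ?B + card ?C"
    by (rule card_Un_le)
  also have "card ?B = 2 * s * K + 1"
    by (simp add: card_cartesian_product flip: of_nat_mult)
  also have "card ?C = L"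
    by (simp add: card_cartesian_product)
  finally show "card (label K t (K * L) ` S) \<le> 2 * s * K + 1 + L" .
qed

text \<open>
  For \<open>r ^ 3 \<le> n < (r + 1) ^ 3\<close> all cells have length \<open>1 / r\<^sup>2\<close>, except that the one with index
  \<open>n - r ^ 3\<close> is cut into \<open>r\<^sup>2\<close> pieces. As \<open>n\<close> runs through \<open>r ^ 3, \<dots>, r ^ 3 + r\<^sup>2 - 1\<close>, the cut cell
  sweeps over \<open>[0, 1)\<close>.
\<close>

definition partitions :: "nat \<Rightarrow> real set set" where
  "partitions n = (let r = icbrt n in fibres (label (r\<^sup>2) (int (n - r ^ 3)) (r\<^sup>2 * r\<^sup>2)))"

lemma borel_partition_partitions: "borel_partition (partitions n)"
  unfolding partitions_def Let_def by (rule borel_partition_fibres) measurable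

lemma partitions_ediam_le:
  assumes "A \<in> partitions n" "0 < icbrt n"
  shows "ediam A \<le> ennreal (1 / real (icbrt n))"
proof -
  obtain t D c where "A = label ((icbrt n)\<^sup>2) t D -` {c}"
    using assms(1) unfolding partitions_def Let_def fibres_def by blast
  then have "ediam A \<le> ennreal (1 / real ((icbrt n)\<^sup>2))"
    using ediam_fibre_label_le assms(2) by (metis zero_less_power)
  also have "\<dots> \<le> ennreal (1 / real (icbrt n))"
    using assms(2) by (intro ennreal_leI frac_le) (simp_all add: power2_eq_square)
  finally show ?thesis .
qed

text \<open>The pieces of the cut cell number only \<open>r^2\<close>, the same order as the uncut
  cells meeting a bounded set. So the count is of order \<open>r^2\<close>, while \<open>n\<close>
  is at least \<open>r^3\<close>.\<close>

lemma cells_meeting_partitions: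
  assumes S: "S \<subseteq> {- real s..real s}" and r: "0 < icbrt n"
  shows "finite (cells_meeting (partitions n) S)"
    and "real (card (cells_meeting (partitions n) S)) / real n \<le> real (2 * s + 2) / real (icbrt n)"
proof -
  let ?r = "icbrt n"
  let ?f = "label (?r\<^sup>2) (int (n - ?r ^ 3)) (?r\<^sup>2 * ?r\<^sup>2)"
  have meet: "cells_meeting (partitions n) S = (\<lambda>c. ?f -` {c}) ` ?f ` S"
    by (simp add: partitions_def Let_def cells_meeting_fibres)
  have fin: "finite (?f ` S)" and card: "card (?f ` S) \<le> 2 * s * ?r\<^sup>2 + 1 + ?r\<^sup>2"
    by (rule card_label_image_le[OF S], simp add: r)+
  show "finite (cells_meeting (partitions n) S)"
    unfolding meet using fin by (rule finite_imageI)
  have "card (cells_meeting (partitions n) S) \<le> 2 * s * ?r\<^sup>2 + 1 + ?r\<^sup>2"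
    unfolding meet using card_image_le[OF fin] card by (rule order_trans)
  also have "\<dots> \<le> (2 * s + 2) * ?r\<^sup>2"
    using r by (simp add: algebra_simps Suc_le_eq)
  finally have "real (card (cells_meeting (partitions n) S)) \<le> real ((2 * s + 2) * ?r\<^sup>2)"
    by (simp only: of_nat_le_iff)
  moreover have "real (?r ^ 3) \<le> real n"
    using icbrt_cube_le by (simp only: of_nat_le_iff)
  ultimately have "real (card (cells_meeting (partitions n) S)) / real n
      \<le> real ((2 * s + 2) * ?r\<^sup>2) / real (?r ^ 3)"
    using r by (intro frac_le) simp_all
  also have "\<dots> = real (2 * s + 2) / real ?r"
    using r by (simp add: field_simps power2_eq_square power3_eq_cube)
  finally show "real (card (cells_meeting (partitions n) S)) / real n \<le> real (2 * s + 2) / real ?r" .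
qed

lemma fine_partitions_partitions: "fine_partitions partitions"
  unfolding fine_partitions_def
proof (intro allI impI)
  fix S assume "symmetric_bounded_interval S"
  then have "bounded S"
    by (simp add: symmetric_bounded_interval_def)
  then obtain b where b: "\<And>x. x \<in> S \<Longrightarrow> \<bar>x\<bar> \<le> b"
    by (auto simp: bounded_iff)
  obtain s where "b \<le> real s"
    using real_arch_simple by blast
  then have S: "S \<subseteq> {- real s..real s}"
    using b by fastforce
  \<comment> \<open>This discards \<open>n = 0\<close>, where the mesh and the bounds in terms of
    \<open>1 / icbrt n\<close> lose their meaning.\<close>
  have r: "\<forall>\<^sub>F n in sequentially. 0 < icbrt n"
    using filterlim_icbrt[unfolded filterlim_at_top, rule_format, of 1] by eventually_elim simp
  have r_lim: "filterlim (\<lambda>n. real (icbrt n)) at_top sequentially"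
    by (rule filterlim_compose[OF filterlim_real_sequentially filterlim_icbrt])
  have "(\<lambda>n. SUP A\<in>cells_meeting (partitions n) S. ediam A) \<longlonglongrightarrow> 0"
  proof (rule tendsto_sandwich[of "\<lambda>_. 0"])
    show "\<forall>\<^sub>F n in sequentially. (SUP A\<in>cells_meeting (partitions n) S. ediam A) \<le> ennreal (1 / real (icbrt n))"
      using r by eventually_elim
        (auto intro!: SUP_least partitions_ediam_le simp: cells_meeting_def)
    have "(\<lambda>n. 1 / real (icbrt n)) \<longlonglongrightarrow> 0"
      by (rule real_tendsto_divide_at_top[OF tendsto_const r_lim])
    then show "(\<lambda>n. ennreal (1 / real (icbrt n))) \<longlonglongrightarrow> 0"
      using tendsto_ennrealI by fastforce
  qed simp_all
  moreover have "\<forall>\<^sub>F n in sequentially. finite (cells_meeting (partitions n) S)"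
    using r by eventually_elim (rule cells_meeting_partitions[OF S])
  moreover have "(\<lambda>n. real (card (cells_meeting (partitions n) S)) / real n) \<longlonglongrightarrow> 0"
  proof (rule tendsto_sandwich[of "\<lambda>_. 0"])
    show "\<forall>\<^sub>F n in sequentially. real (card (cells_meeting (partitions n) S)) / real n
        \<le> real (2 * s + 2) / real (icbrt n)"
      using r by eventually_elim (rule cells_meeting_partitions[OF S])
    show "(\<lambda>n. real (2 * s + 2) / real (icbrt n)) \<longlonglongrightarrow> 0"
      by (rule real_tendsto_divide_at_top[OF tendsto_const r_lim])
  qed simp_all
  ultimately show "(\<lambda>n. SUP A\<in>cells_meeting (partitions n) S. ediam A) \<longlonglongrightarrow> 0 \<and>
      (\<forall>\<^sub>F n in sequentially. finite (cells_meeting (partitions n) S)) \<and>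
      (\<lambda>n. real (card (cells_meeting (partitions n) S)) / real n) \<longlonglongrightarrow> 0"
    by blast
qed

subsection \<open>Uniform marginals\<close>

abbreviation unif :: "real measure" where
  "unif \<equiv> uniform_measure lborel {0..<1}"

interpretation unif: iid_sequence unif
  by (intro iid_sequence.intro iid_sequence_axioms.intro prob_space_uniform_measure) simp_all

lemma AE_unif: "AE x in unif. 0 \<le> x \<and> x < 1"
  by (simp add: AE_uniform_measure)

lemma unif_eq_density: "unif = density lborel (\<lambda>x. ennreal (indicator {0..<1} x))"
  by (auto simp: uniform_measure_def ennreal_indicator divide_ennreal_def intro!: density_cong)

lemma integrable_unif: "integrable unif (\<lambda>x. x)"
proof (rule unif.integrable_const_bound[of _ 1])
  show "AE x in unif. norm x \<le> 1"
    using AE_unif by eventually_elim auto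
qed (simp add: measurable_ident_sets)

lemma expectation_unif: "unif.expectation (\<lambda>x. x) = 1 / 2"
proof -
  have "unif.expectation (\<lambda>x. x) = (LINT x|lborel. indicator {0..<1} x * x)"
    unfolding unif_eq_density by (subst integral_density) auto
  \<comment> \<open>Passing to the closed interval changes the integrand only at the null set {1}
    and gives the form to which the power rule applies.\<close>
  also have "\<dots> = (LINT x|lborel. x ^ 1 * indicator {0..1} x)"
  proof (rule integral_cong_AE)
    show "AE x in lborel. indicator {0..<1} x * x = x ^ 1 * indicator {0..1::real} x"
      using AE_lborel_singleton[of 1] by eventually_elim (auto simp: indicator_def)
  qed auto
  also have "\<dots> = 1 / 2"
    by (subst integral_power) auto
  finally show ?thesis .
qed

lemma prob_unif_floor:
  assumes "0 < D" "c < D"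
  shows "unif.prob {x. \<lfloor>real D * x\<rfloor> = int c} = 1 / real D"
proof -
  let ?S = "{x. \<lfloor>real D * x\<rfloor> = int c}"
  have S: "{0..<1} \<inter> {x. \<lfloor>real D * x\<rfloor> = int c} = {real c / real D..<(real c + 1) / real D}"
  proof (rule set_eqI)
    fix x
    \<comment> \<open>Since \<open>c < D\<close>, the grid cell lies inside [0, 1), and intersecting
      with the support cuts nothing off.\<close>
    have "(real c + 1) / real D \<le> 1" "0 \<le> real c / real D"
      using assms by simp_all
    moreover have "\<lfloor>real D * x\<rfloor> = int c \<longleftrightarrow> real c / real D \<le> x \<and> x < (real c + 1) / real D"
      using assms(1) by (simp add: floor_eq_iff pos_divide_le_eq pos_less_divide_eq mult.commute)
    ultimately show "x \<in> {0..<1} \<inter> ?S \<longleftrightarrow> x \<in> {real c / real D..<(real c + 1) / real D}"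
      unfolding Int_iff mem_Collect_eq atLeastLessThan_iff by linarith
  qed
  have "unif.prob ?S = measure lborel ({0..<1} \<inter> ?S) / measure lborel {0..<1::real}"
    by (rule measure_uniform_measure) simp_all
  also have "\<dots> = (real c + 1) / real D - real c / real D"
    unfolding S by (simp add: divide_right_mono)
  also have "\<dots> = 1 / real D"
    by (simp add: add_divide_distrib)
  finally show ?thesis .
qed

text \<open>Almost surely the common floor is one of \<open>0, ..., D - 1\<close>. By independence
  both coordinates lie in a given grid cell with probability \<open>1 / D^2\<close>, and there are
  \<open>D\<close> cells.\<close>

lemma prob_floor_eq_le:
  assumes "i \<noteq> j" "0 < D"
  shows "unif.iid.prob {\<omega>. \<lfloor>real D * \<omega> i\<rfloor> = \<lfloor>real D * \<omega> j\<rfloor>} \<le> 1 / real D"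
proof -
  let ?I = "\<lambda>c. {x. \<lfloor>real D * x\<rfloor> = int c}"
  have I [measurable]: "?I c \<in> sets borel" for c
    by measurable
  have sets_pair: "{\<omega>. \<omega> i \<in> ?I c \<and> \<omega> j \<in> ?I c} \<in> unif.iid.events" for c
  proof -
    have "{\<omega> \<in> space unif.iid. \<omega> i \<in> ?I c \<and> \<omega> j \<in> ?I c} \<in> unif.iid.events"
      by measurable
    then show ?thesis by simp
  qed
  have "AE \<omega> in unif.iid. 0 \<le> \<omega> i \<and> \<omega> i < 1"
    using AE_unif by (rule unif.iid.AE_component[OF UNIV_I])
  then have "AE \<omega> in unif.iid. \<omega> \<in> {\<omega>. \<lfloor>real D * \<omega> i\<rfloor> = \<lfloor>real D * \<omega> j\<rfloor>}
      \<longrightarrow> \<omega> \<in> (\<Union>c<D. {\<omega>. \<omega> i \<in> ?I c \<and> \<omega> j \<in> ?I c})"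
  proof eventually_elim
    case (elim \<omega>)
    then have "0 \<le> real D * \<omega> i" "real D * \<omega> i < real D"
      using assms(2) by simp_all
    then have "nat \<lfloor>real D * \<omega> i\<rfloor> < D" "int (nat \<lfloor>real D * \<omega> i\<rfloor>) = \<lfloor>real D * \<omega> i\<rfloor>"
      by (simp_all add: nat_less_iff floor_less_iff)
    then show ?case
      by force
  qed
  then have "unif.iid.prob {\<omega>. \<lfloor>real D * \<omega> i\<rfloor> = \<lfloor>real D * \<omega> j\<rfloor>}
      \<le> unif.iid.prob (\<Union>c<D. {\<omega>. \<omega> i \<in> ?I c \<and> \<omega> j \<in> ?I c})"
    by (rule unif.iid.finite_measure_mono_AE) (intro sets.finite_UN finite_lessThan sets_pair)
  also have "\<dots> \<le> (\<Sum>c<D. unif.iid.prob {\<omega>. \<omega> i \<in> ?I c \<and> \<omega> j \<in> ?I c})"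
    by (rule unif.iid.finite_measure_subadditive_finite) (auto intro!: sets_pair[simplified])
  also have "\<dots> = (\<Sum>c<D. 1 / real D * (1 / real D))"
    by (intro sum.cong refl)
       (simp only: unif.prob_coord_pair[OF assms(1) I I] prob_unif_floor[OF assms(2)] lessThan_iff)
  also have "\<dots> = 1 / real D"
    by simp
  finally show ?thesis .
qed

section \<open>The forecast along the blocks\<close>

definition own_estimate :: "nat \<Rightarrow> (int \<Rightarrow> real) \<Rightarrow> real" where
  "own_estimate n \<omega> = partitioning_estimate (partitions n) n \<omega> (\<omega> (- 1))"

text \<open>The cell in the forecaster depends on the random point itself; expressing membership by
  floors of both points makes joint measurability evident.\<close>

lemma indicator_cell_label:
  "indicator (cell (fibres (label K t D)) x) y =
     (of_bool (\<lfloor>real K * y\<rfloor> = \<lfloor>real K * x\<rfloor> \<and> (\<lfloor>real K * x\<rfloor> = t \<longrightarrow> \<lfloor>real D * y\<rfloor> = \<lfloor>real D * x\<rfloor>)) :: real)"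
  by (auto simp: cell_fibres label_def indicator_def)

lemma measurable_own_estimate [measurable]: "own_estimate n \<in> borel_measurable unif.iid"
  unfolding own_estimate_def[abs_def] partitioning_estimate_def partitions_def Let_def indicator_cell_label
  by measurable

text \<open>At this time the cell of the point at -1 is the one being cut, so a data point sharing
  it would agree with that point on the grid of mesh \<open>r ^ (- 4)\<close>. As
  \<open>empty\<close> forbids this, all indicators vanish and the quotient is 0/0.\<close>

lemma own_estimate_eq_0:
  assumes n: "n = r ^ 3 + t" "t < r\<^sup>2" and t: "\<lfloor>real (r\<^sup>2) * \<omega> (- 1)\<rfloor> = int t"
    and empty: "\<And>i. 2 \<le> i \<Longrightarrow> i \<le> r ^ 3 + r\<^sup>2 \<Longrightarrow> \<lfloor>real (r\<^sup>2 * r\<^sup>2) * \<omega> (- int i)\<rfloor> \<noteq> \<lfloor>real (r\<^sup>2 * r\<^sup>2) * \<omega> (- 1)\<rfloor>"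
  shows "own_estimate n \<omega> = 0"
proof -
  \<comment> \<open>The expansion shows that \<open>r ^ 3 + t\<close> with \<open>t < r^2\<close>
    stays below \<open>(r + 1) ^ 3\<close>, so the whole sweep happens within block
    \<open>r\<close>.\<close>
  have "Suc r ^ 3 = r ^ 3 + 3 * r\<^sup>2 + 3 * r + 1"
    by (simp add: power2_eq_square power3_eq_cube algebra_simps)
  then have "icbrt n = r"
    using n by (intro icbrt_eqI) auto
  then have P: "partitions n = fibres (label (r\<^sup>2) (int t) (r\<^sup>2 * r\<^sup>2))"
    using n by (simp add: partitions_def)
  have "indicator (cell (partitions n) (\<omega> (- 1))) (\<omega> (- 1 - int i)) = (0 :: real)" if "i \<in> {1..<n}" for i
  proof -
    \<comment> \<open>The observations compared with the cell have time indices from -2 down to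
      \<open>- int n\<close>, and \<open>n < r ^ 3 + r^2\<close>; this is the range covered by
      \<open>empty\<close>.\<close>
    have "\<lfloor>real (r\<^sup>2 * r\<^sup>2) * \<omega> (- int (Suc i))\<rfloor> \<noteq> \<lfloor>real (r\<^sup>2 * r\<^sup>2) * \<omega> (- 1)\<rfloor>"
      using that n by (intro empty) auto
    moreover have "- int (Suc i) = - 1 - int i"
      by simp
    ultimately show ?thesis
      unfolding P indicator_cell_label using t by simp
  qed
  then show ?thesis
    by (simp add: own_estimate_def partitioning_estimate_def)
qed

text \<open>The favourable time in block \<open>r\<close> depends on the random point, so the bad
  event \<open>?B\<close> collects collisions with every observation available up to the end of the
  sweep. At most \<open>2 * r ^ 3\<close> collisions of probability at most \<open>r ^ (- 4)\<close>
  give the bound \<open>2 / r\<close>.\<close>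

lemma prob_own_estimate_0_ge:
  assumes r: "0 < r" "k \<le> r ^ 3"
  shows "1 - 2 / real r \<le> unif.iid.prob {\<omega>. \<exists>n\<ge>k. own_estimate n \<omega> = 0}"
proof -
  define D where "D = r\<^sup>2 * r\<^sup>2"
  let ?N = "r ^ 3 + r\<^sup>2"
  let ?B = "\<Union>i\<in>{2..?N}. {\<omega>. \<lfloor>real D * \<omega> (- int i)\<rfloor> = \<lfloor>real D * \<omega> (- 1)\<rfloor>}"
  let ?E = "{\<omega>. \<exists>n\<ge>k. own_estimate n \<omega> = 0}"
  have E [measurable]: "?E \<in> unif.iid.events"
  proof -
    have "{\<omega> \<in> space unif.iid. \<exists>n\<ge>k. own_estimate n \<omega> = 0} \<in> unif.iid.events"
      by measurable
    then show ?thesis by simp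
  qed
  have set: "{\<omega>. \<lfloor>real D * \<omega> i\<rfloor> = \<lfloor>real D * \<omega> j\<rfloor>} \<in> unif.iid.events" for i j
  proof -
    have "{\<omega> \<in> space unif.iid. \<lfloor>real D * \<omega> i\<rfloor> = \<lfloor>real D * \<omega> j\<rfloor>} \<in> unif.iid.events"
      by measurable
    then show ?thesis by simp
  qed
  have "AE \<omega> in unif.iid. 0 \<le> \<omega> (- 1) \<and> \<omega> (- 1) < 1"
    using AE_unif by (rule unif.iid.AE_component[OF UNIV_I])
  then have "AE \<omega> in unif.iid. \<omega> \<in> UNIV - ?E \<longrightarrow> \<omega> \<in> ?B"
  proof eventually_elim
    case (elim \<omega>)
    \<comment> \<open>The index of the coarse cell containing the point: this cell is cut at time
      \<open>r ^ 3 + ?t\<close>.\<close>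
    let ?t = "nat \<lfloor>real (r\<^sup>2) * \<omega> (- 1)\<rfloor>"
    have "0 \<le> real (r\<^sup>2) * \<omega> (- 1)" "real (r\<^sup>2) * \<omega> (- 1) < real (r\<^sup>2)"
      using elim r by simp_all
    then have "?t < r\<^sup>2" "\<lfloor>real (r\<^sup>2) * \<omega> (- 1)\<rfloor> = int ?t"
      by (simp_all add: nat_less_iff floor_less_iff)
    then have "own_estimate (r ^ 3 + ?t) \<omega> = 0" if "\<omega> \<notin> ?B"
      using that by (intro own_estimate_eq_0[OF refl]) (auto simp: D_def)
    moreover have "k \<le> r ^ 3 + ?t"
      using r by simp
    ultimately show ?case
      by blast
  qed
  then have "unif.iid.prob (UNIV - ?E) \<le> unif.iid.prob ?B"
    by (rule unif.iid.finite_measure_mono_AE) (auto intro!: sets.finite_UN set)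
  also have "\<dots> \<le> (\<Sum>i\<in>{2..?N}. unif.iid.prob {\<omega>. \<lfloor>real D * \<omega> (- int i)\<rfloor> = \<lfloor>real D * \<omega> (- 1)\<rfloor>})"
    by (rule unif.iid.finite_measure_subadditive_finite) (auto intro!: set)
  also have "\<dots> \<le> (\<Sum>i\<in>{2..?N}. 1 / real D)"
    using r by (intro sum_mono prob_floor_eq_le) (auto simp: D_def)
  also have "\<dots> \<le> real ?N / real D"
    by (simp add: divide_right_mono flip: of_nat_power of_nat_add)
  also have "\<dots> \<le> (2 * real r ^ 3) / real D"
    using r by (intro divide_right_mono) (simp_all add: D_def power2_eq_square power3_eq_cube)
  also have "\<dots> = 2 / real r"
    using r by (simp add: D_def field_simps power2_eq_square power3_eq_cube)
  finally show ?thesis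
    using unif.iid.prob_compl[OF E] by simp
qed

text \<open>For fixed \<open>k\<close> the event does not depend on \<open>r\<close>, while its
  probability is at least \<open>1 - 2 / r\<close> for all large \<open>r\<close>. Letting
  \<open>r\<close> grow gives probability 1, and countably many \<open>k\<close> can be
  combined.\<close>

lemma AE_own_estimate_0_infinitely_often: "AE \<omega> in unif.iid. \<forall>k. \<exists>n\<ge>k. own_estimate n \<omega> = 0"
proof (subst AE_all_countable, intro allI)
  fix k
  let ?E = "{\<omega>. \<exists>n\<ge>k. own_estimate n \<omega> = 0}"
  have "\<forall>\<^sub>F r in sequentially. 1 - 2 / real r \<le> unif.iid.prob ?E"
    using eventually_gt_at_top[of 0] eventually_ge_at_top[of k]
  proof eventually_elim
    case (elim r)
    then have "k \<le> r ^ 3"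
      by (metis le_trans self_le_power zero_less_numeral Suc_leI One_nat_def)
    then show ?case
      using elim(1) by (intro prob_own_estimate_0_ge)
  qed
  moreover have "(\<lambda>r. 1 - 2 / real r) \<longlonglongrightarrow> 1 - 0"
    by (intro tendsto_intros real_tendsto_divide_at_top[OF tendsto_const filterlim_real_sequentially])
  ultimately have "1 \<le> unif.iid.prob ?E"
    using tendsto_upperbound[of "\<lambda>r. 1 - 2 / real r" "1 - 0" sequentially] by simp
  moreover have "{\<omega> \<in> space unif.iid. \<exists>n\<ge>k. own_estimate n \<omega> = 0} \<in> unif.iid.events"
    by measurable
  ultimately show "AE \<omega> in unif.iid. \<exists>n\<ge>k. own_estimate n \<omega> = 0"
    using unif.iid.prob_eq_1[of ?E] by (simp add: order_antisym)
qed

theorem theorem3: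
  "\<exists>(M :: (int \<Rightarrow> real) measure) (X :: int \<Rightarrow> (int \<Rightarrow> real) \<Rightarrow> real)
     (P :: nat \<Rightarrow> real set set) (m :: real \<Rightarrow> real).
     real_process M X \<and> stationary M X \<and> ergodic M X \<and>
     (\<forall>i. distr M borel (X i) = uniform_measure lborel {0..<1}) \<and>
     (\<forall>n. borel_partition (P n)) \<and> fine_partitions P \<and>
     regression_function M (X 0) (X (- 1)) m \<and>
     measure M {\<omega> \<in> space M.
        limsup (\<lambda>n. ereal \<bar>partitioning_estimate (P n) n (trajectory X \<omega>) (X (- 1) \<omega>)
                            - m (X (- 1) \<omega>)\<bar>) \<ge> ereal (1 / 2)} \<ge> 1 / 2"
proof (intro exI conjI allI)
  let ?L = "\<lambda>\<omega>. limsup (\<lambda>n. ereal \<bar>own_estimate n \<omega> - 1 / 2\<bar>)"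
  have "AE \<omega> in unif.iid. ereal (1 / 2) \<le> ?L \<omega>"
    using AE_own_estimate_0_infinitely_often
  proof eventually_elim
    case (elim \<omega>)
    \<comment> \<open>Every tail contains a time at which the forecast is 0 and the error is exactly
      1/2, so each tail supremum, and hence their infimum, is at least 1/2.\<close>
    have "ereal (1 / 2) \<le> (SUP n\<in>{k..}. ereal \<bar>own_estimate n \<omega> - 1 / 2\<bar>)" for k
    proof -
      obtain n where "n \<ge> k" "own_estimate n \<omega> = 0"
        using elim by blast
      then show ?thesis
        by (intro SUP_upper2[of n]) auto
    qed
    then show ?case
      by (simp add: limsup_INF_SUP le_INF_iff)
  qed
  moreover have "{\<omega> \<in> space unif.iid. ereal (1 / 2) \<le> ?L \<omega>} \<in> unif.iid.events"
    by measurable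
  \<comment> \<open>The event even has full probability, which is more than the required
    1/2.\<close>
  ultimately have "unif.iid.prob {\<omega> \<in> space unif.iid. ereal (1 / 2) \<le> ?L \<omega>} = 1"
    by (subst unif.iid.prob_Collect_eq_1) auto
  then show "measure unif.iid {\<omega> \<in> space unif.iid.
      limsup (\<lambda>n. ereal \<bar>partitioning_estimate (partitions n) n (trajectory (\<lambda>i \<omega>. \<omega> i) \<omega>) (\<omega> (- 1)) - 1 / 2\<bar>)
        \<ge> ereal (1 / 2)} \<ge> 1 / 2"
    by (simp add: own_estimate_def trajectory_def)
  show "regression_function unif.iid (\<lambda>\<omega>. \<omega> 0) (\<lambda>\<omega>. \<omega> (- 1)) (\<lambda>_. 1 / 2)"
    using unif.regression_function_iid[OF integrable_unif] by (simp add: expectation_unif)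
qed (rule unif.real_process_iid unif.stationary_iid unif.ergodic_iid unif.distr_coord
    borel_partition_partitions fine_partitions_partitions)+

end
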